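(* There exist $2^{\aleph_0}$ incomparable, pathwise connected, compact subspaces of $\mathbb{R}^3$.
   Context: $\mathbb{R}^3$ carries the Euclidean topology. Spaces $X_i$ $(i\in I)$ are called incomparable if $X_i$ is not homeomorphic to a subspace of $X_j$ whenever $i,j\in I$ and $i\neq j$. *)

theory Defs
  imports "HOL-Analysis.Analysis" "HOL-Library.Equipollence"
begin

definition incomparable :: "'i set \<Rightarrow> ('i \<Rightarrow> 'a::topological_space set) \<Rightarrow> bool" where
  "incomparable I X \<longleftrightarrow>
     (\<forall>i\<in>I. \<forall>j\<in>I. i \<noteq> j \<longrightarrow> \<not> (\<exists>S. S \<subseteq> X j \<and> X i homeomorphic S))"

end

theory Submission imports Defs begin

text \<open>
  The spaces are plane cacti: circles hanging together at single points. A compact set that stays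
  connected after the deletion of any one point cannot straddle a junction of such a cactus, so
  every simple closed curve in a cactus lies inside one of its circles, and then it is that circle,
  since no proper part of a circle contains another one. An embedding of one cactus into another
  therefore carries circles onto circles and touching circles onto touching circles: it induces an
  injective homomorphism between the trees that record which circles touch. Edges of
  these trees cannot be subdivided, so a long chain between two branchings cannot stand in for a
  shorter one, and antichains become possible.

  For a set \<open>A\<close> of naturals take a one-sided infinite chain of circles, each half as large as the
  one before, that shrinks to the origin, and hang a small leaf circle on top of the chain circle
  with number \<open>n + 2\<close> exactly if \<open>n \<in> A\<close>. Chain circle number 1 carries two leaves and is the only
  circle that touches four others. A homomorphism of trees as above fixes it, hence
  fixes the whole chain beyond it (a leaf or the initial circle would be a dead end), hence
  maps a leaf at a position beyond 1 to a leaf at the same position. So the cactus of \<open>A\<close> embeds in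
  the cactus of \<open>B\<close> only if \<open>A \<subseteq> B\<close> (\<open>cactus_embedding_imp_subset\<close>), and the \<open>2 ^ \<aleph>\<^sub>0\<close> sets
  \<open>parity_code S\<close>, which are pairwise incomparable under inclusion, yield incomparable spaces.
\<close>

section \<open>Simple closed curves in the plane\<close>

lemma image_sphere_no_cut_point:
  fixes f :: "complex \<Rightarrow> complex"
  assumes f: "continuous_on (sphere a r) f" "inj_on f (sphere a r)" and r: "r > 0"
  shows "connected (f ` sphere a r - {p})"
proof (cases "p \<in> f ` sphere a r")
  case True
  then obtain q where q: "q \<in> sphere a r" "p = f q" by blast
  have "sphere a r - {q} homeomorphic (UNIV :: real set)"
    by (rule homeomorphic_punctured_sphere_affine) (use r q in auto)
  then have "connected (sphere a r - {q})"
    using homeomorphic_connectedness by (metis connected_UNIV)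
  then have "connected (f ` (sphere a r - {q}))"
    by (rule connected_continuous_image[OF continuous_on_subset[OF f(1)], rotated]) auto
  moreover have "f ` (sphere a r - {q}) = f ` sphere a r - {p}"
    using f(2) q by (auto simp: inj_on_def)
  ultimately show ?thesis by simp
next
  case False
  moreover have "connected (f ` sphere a r)"
    by (rule connected_continuous_image[OF f(1)]) (rule connected_sphere, simp)
  ultimately show ?thesis by simp
qed

text \<open>
  A curve that misses a point of the target circle would embed a circle in the line.
\<close>

lemma embedded_circle_in_circle:
  fixes f :: "complex \<Rightarrow> complex"
  assumes f: "continuous_on (sphere a r) f" "inj_on f (sphere a r)" and r: "r > 0"
    and sub: "f ` sphere a r \<subseteq> sphere b s" and s: "s > 0"
  shows "f ` sphere a r = sphere b s"
proof (rule ccontr)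
  assume "f ` sphere a r \<noteq> sphere b s"
  then obtain q where q: "q \<in> sphere b s" "q \<notin> f ` sphere a r" using sub by blast
  have "sphere b s - {q} homeomorphic (UNIV :: real set)"
    by (rule homeomorphic_punctured_sphere_affine) (use s q in auto)
  then obtain h k where h: "homeomorphism (sphere b s - {q}) (UNIV :: real set) h k"
    unfolding homeomorphic_def by blast
  have sub': "f ` sphere a r \<subseteq> sphere b s - {q}" using sub q by blast
  have "continuous_on (sphere a r) (h \<circ> f)"
    using continuous_on_compose[OF f(1)] continuous_on_subset[OF homeomorphism_cont1[OF h] sub'] by blast
  moreover have "inj_on (h \<circ> f) (sphere a r)"
    by (rule comp_inj_on[OF f(2)])
      (metis h inj_on_subset sub' homeomorphism_apply1 inj_on_inverseI)
  ultimately have "DIM(complex) \<le> DIM(real)" using r by (rule no_embedding_sphere_lowdim)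
  then show False by simp
qed

text \<open>
  If the level set \<open>\<phi> = c\<close> meets \<open>T\<close> at most in \<open>p\<close>, the two sides of that level disconnect
  \<open>T - {p}\<close> unless one of them is empty. This is how curves are confined to one side of a junction.
\<close>

lemma no_cut_point_one_sided:
  fixes \<phi> :: "'a::t1_space \<Rightarrow> real"
  assumes con: "connected (T - {p})" and \<phi>: "continuous_on UNIV \<phi>" "\<phi> p = c"
    and meet: "\<And>z. z \<in> T \<Longrightarrow> \<phi> z = c \<Longrightarrow> z = p"
  shows "(\<forall>z\<in>T. \<phi> z \<le> c) \<or> (\<forall>z\<in>T. c \<le> \<phi> z)"
proof -
  have cl: "closed {z. \<phi> z \<le> c}" "closed {z. c \<le> \<phi> z}"
    using \<phi>(1) by (auto intro!: closed_Collect_le continuous_intros)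
  have "{z. \<phi> z \<le> c} \<inter> (T - {p}) = {} \<or> {z. c \<le> \<phi> z} \<inter> (T - {p}) = {}"
    by (rule connected_closedD[OF con _ _ cl]) (use meet in fastforce)+
  then show ?thesis
  proof
    assume *: "{z. \<phi> z \<le> c} \<inter> (T - {p}) = {}"
    have "c \<le> \<phi> z" if "z \<in> T" for z
    proof (cases "z = p")
      case False
      then have "z \<notin> {z. \<phi> z \<le> c}" using * that by blast
      then show ?thesis by simp
    qed (use \<phi>(2) in simp)
    then show ?thesis by blast
  next
    assume *: "{z. c \<le> \<phi> z} \<inter> (T - {p}) = {}"
    have "\<phi> z \<le> c" if "z \<in> T" for z
    proof (cases "z = p")
      case False
      then have "z \<notin> {z. c \<le> \<phi> z}" using * that by blast
      then show ?thesis by simp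
    qed (use \<phi>(2) in simp)
    then show ?thesis by blast
  qed
qed

lemma sphere_in_box:
  assumes "z \<in> sphere c r"
  shows "\<bar>Re z - Re c\<bar> \<le> r" "\<bar>Im z - Im c\<bar> \<le> r"
  using assms abs_Re_le_cmod[of "z - c"] abs_Im_le_cmod[of "z - c"]
  by (auto simp: dist_norm norm_minus_commute)

lemma mem_sphere_complex:
  "r \<ge> 0 \<Longrightarrow> z \<in> sphere c r \<longleftrightarrow> (Re z - Re c)\<^sup>2 + (Im z - Im c)\<^sup>2 = r\<^sup>2"
proof -
  assume "r \<ge> 0"
  then have "z \<in> sphere c r \<longleftrightarrow> (cmod (z - c))\<^sup>2 = r\<^sup>2"
    by (simp add: dist_norm norm_minus_commute)
  then show ?thesis by (simp add: cmod_power2)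
qed

lemma sphere_extreme_Re:
  assumes "z \<in> sphere c r" "\<bar>Re z - Re c\<bar> = r"
  shows "Im z = Im c"
proof -
  have "r \<ge> 0" using assms by linarith
  then have "(Re z - Re c)\<^sup>2 + (Im z - Im c)\<^sup>2 = r\<^sup>2" using assms mem_sphere_complex by blast
  moreover have "(Re z - Re c)\<^sup>2 = r\<^sup>2" using assms(2) by (metis power2_abs)
  ultimately show ?thesis by simp
qed

lemma sphere_extreme_Im:
  assumes "z \<in> sphere c r" "\<bar>Im z - Im c\<bar> = r"
  shows "Re z = Re c"
proof -
  have "r \<ge> 0" using assms by linarith
  then have "(Re z - Re c)\<^sup>2 + (Im z - Im c)\<^sup>2 = r\<^sup>2" using assms mem_sphere_complex by blast
  moreover have "(Im z - Im c)\<^sup>2 = r\<^sup>2" using assms(2) by (metis power2_abs)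
  ultimately show ?thesis by simp
qed

section \<open>The cactus of a set of naturals\<close>

text \<open>
  The node \<open>(n, 0)\<close> is the \<open>n\<close>-th circle of the chain. Its horizontal diameter is the interval
  \<open>[2 * scale n, 4 * scale n]\<close>, so that consecutive circles are tangent and the whole figure is built from
  copies of one pattern scaled towards 0. The nodes \<open>(n, 1)\<close> and \<open>(n, -1)\<close> are leaves tangent to this
  circle at its top and its bottom. Leaves have half the radius, so they stay strictly inside
  the vertical strip of their chain circle and touch no other circle.
\<close>

definition scale :: "nat \<Rightarrow> real" where "scale n = (1/2)^n"

lemma scale_pos [simp]: "scale n > 0" by (simp add: scale_def)
lemma scale_nonneg [simp]: "scale n \<ge> 0" by (simp add: scale_def)
lemma abs_scale [simp]: "\<bar>scale n\<bar> = scale n" by simp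
lemma scale_not_nonpos [simp]: "\<not> scale n \<le> 0" by (simp add: not_le)
lemma scale_nonzero [simp]: "scale n \<noteq> 0" by (simp add: scale_def)
lemma scale_0 [simp]: "scale 0 = 1" by (simp add: scale_def)
lemma scale_Suc: "scale (Suc n) = scale n / 2" by (simp add: scale_def)
lemma scale_less: "m < n \<Longrightarrow> 2 * scale n \<le> scale m"
proof -
  assume "m < n"
  then have "scale n \<le> scale (Suc m)" unfolding scale_def by (intro power_decreasing) auto
  then show ?thesis by (simp add: scale_Suc)
qed
lemma scale_inj: "scale m = scale n \<Longrightarrow> m = n"
  using scale_less[of m n] scale_less[of n m] scale_pos[of n] by (cases m n rule: linorder_cases) auto

lemma scale_small: "e > 0 \<Longrightarrow> \<exists>n. scale n < e"
  unfolding scale_def using real_arch_pow_inv[of e "1/2"] by auto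

definition rad :: "nat \<times> int \<Rightarrow> real" where
  "rad i = (if snd i = 0 then scale (fst i) else scale (fst i) / 2)"
definition centre :: "nat \<times> int \<Rightarrow> complex" where
  "centre i = Complex (3 * scale (fst i)) (3/2 * scale (fst i) * of_int (snd i))"
abbreviation circle :: "nat \<times> int \<Rightarrow> complex set" where
  "circle i \<equiv> sphere (centre i) (rad i)"

definition adjacent :: "nat \<times> int \<Rightarrow> nat \<times> int \<Rightarrow> bool" where
  "adjacent i j \<longleftrightarrow>
     snd i = 0 \<and> snd j = 0 \<and> (fst i = Suc (fst j) \<or> fst j = Suc (fst i)) \<or>
     fst i = fst j \<and> (snd i = 0) \<noteq> (snd j = 0)"

text \<open>
  The two leaves at position 1 make it the only circle with four neighbours; position 0 never
  carries a leaf, so its circle has a single neighbour.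
\<close>

definition nodes :: "nat set \<Rightarrow> (nat \<times> int) set" where
  "nodes A = range (\<lambda>n. (n, 0)) \<union> {(1, 1), (1, -1)} \<union> (\<lambda>n. (n + 2, 1)) ` A"

definition cactus :: "nat set \<Rightarrow> complex set" where
  "cactus A = insert 0 (\<Union>i\<in>nodes A. circle i)"

lemma rad_pos [simp]: "rad i > 0" by (simp add: rad_def)
lemma nodes_snd: "i \<in> nodes A \<Longrightarrow> snd i \<in> {-1, 0, 1}" by (auto simp: nodes_def)

lemma circle_inj:
  assumes "circle i = circle j" shows "i = j"
proof -
  have ext: "Re (centre i) + rad i \<le> Re (centre j) + rad j"
    "Re (centre j) - rad j \<le> Re (centre i) - rad i"
    "Im (centre i) + rad i \<le> Im (centre j) + rad j"
    if "circle i = circle j" for i j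
  proof -
    have "centre i + of_real (rad i) \<in> circle i" "centre i - of_real (rad i) \<in> circle i"
      "centre i + \<i> * of_real (rad i) \<in> circle i"
      by (auto simp: dist_norm norm_mult less_imp_le)
    then have "centre i + of_real (rad i) \<in> circle j" "centre i - of_real (rad i) \<in> circle j"
      "centre i + \<i> * of_real (rad i) \<in> circle j" using that by auto
    from this[THEN sphere_in_box(1)] this[THEN sphere_in_box(2)] show
     "Re (centre i) + rad i \<le> Re (centre j) + rad j"
    "Re (centre j) - rad j \<le> Re (centre i) - rad i"
    "Im (centre i) + rad i \<le> Im (centre j) + rad j" by auto
  qed
  have eq: "Re (centre i) = Re (centre j)" "rad i = rad j" "Im (centre i) = Im (centre j)"
    using ext[OF assms] ext[OF assms[symmetric]] by linarith+
  have "fst i = fst j" using eq(1) by (auto simp: centre_def intro: scale_inj)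
  moreover have "snd i = snd j"
    using eq(3) scale_pos[of "fst j"] \<open>fst i = fst j\<close> by (auto simp: centre_def)
  ultimately show ?thesis by (rule prod_eqI)
qed

lemma circle_bounds:
  assumes "z \<in> circle (n, s)"
  shows "2 * scale n \<le> Re z" "Re z \<le> 4 * scale n"
    "s \<noteq> 0 \<Longrightarrow> 2 * scale n < Re z" "s \<noteq> 0 \<Longrightarrow> Re z < 4 * scale n"
    "s = 0 \<Longrightarrow> \<bar>Im z\<bar> \<le> scale n" "s = 1 \<Longrightarrow> scale n \<le> Im z" "s = -1 \<Longrightarrow> Im z \<le> - scale n"
    "s \<in> {-1, 0, 1} \<Longrightarrow> \<bar>Im z\<bar> \<le> 2 * scale n"
proof -
  have box: "Re z \<le> 3 * scale n + rad (n, s)" "3 * scale n - rad (n, s) \<le> Re z"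
    "Im z \<le> 3/2 * scale n * of_int s + rad (n, s)" "3/2 * scale n * of_int s - rad (n, s) \<le> Im z"
    using sphere_in_box[OF assms] by (simp_all add: centre_def abs_le_iff)
  have r: "rad (n, s) \<le> scale n" "s \<noteq> 0 \<Longrightarrow> rad (n, s) = scale n / 2" "s = 0 \<Longrightarrow> rad (n, s) = scale n"
    using scale_pos[of n] by (simp_all add: rad_def less_imp_le)
  note pos = scale_pos[of n]
  show "2 * scale n \<le> Re z" "Re z \<le> 4 * scale n" using box r(1) by linarith+
  show "2 * scale n < Re z" "Re z < 4 * scale n" if "s \<noteq> 0" using box r(2)[OF that] pos by linarith+
  show zero: "\<bar>Im z\<bar> \<le> scale n" if "s = 0" using box r(3)[OF that] that by simp
  show one: "scale n \<le> Im z" if "s = 1" using box r(2) that by simp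
  show mone: "Im z \<le> - scale n" if "s = -1" using box r(2) that by simp
  show "\<bar>Im z\<bar> \<le> 2 * scale n" if "s \<in> {-1, 0, 1}"
    using that box r(2) zero one mone pos by (elim insertE) auto
qed

lemma circle_left_right:
  assumes "z \<in> circle (n, s)"
  shows "Re z = 2 * scale n \<Longrightarrow> z = of_real (2 * scale n)"
    and "Re z = 4 * scale n \<Longrightarrow> z = of_real (4 * scale n)"
proof -
  { assume *: "Re z = 2 * scale n \<or> Re z = 4 * scale n"
    then have s: "s = 0" using circle_bounds(3,4)[OF assms] by force
    have "Im z = Im (centre (n, s))"
      by (rule sphere_extreme_Re[OF assms]) (use * s scale_pos[of n] in \<open>auto simp: rad_def centre_def\<close>)
    then have "Im z = 0" using s by (simp add: centre_def) }
  then show "Re z = 2 * scale n \<Longrightarrow> z = of_real (2 * scale n)"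
     "Re z = 4 * scale n \<Longrightarrow> z = of_real (4 * scale n)" by (auto simp: complex_eq_iff)
qed

lemma circle_top_bottom:
  assumes "z \<in> circle (n, s)" "s \<in> {-1, 0, 1}"
  shows "Im z = scale n \<Longrightarrow> z = Complex (3 * scale n) (scale n)"
    and "Im z = - scale n \<Longrightarrow> z = Complex (3 * scale n) (- scale n)"
proof -
  { assume *: "Im z = scale n \<or> Im z = - scale n"
    have "\<bar>Im z - Im (centre (n, s))\<bar> = rad (n, s)"
      using * assms(2) circle_bounds(6,7)[OF assms(1)] scale_pos[of n]
      by (elim insertE) (auto simp: rad_def centre_def)
    then have "Re z = 3 * scale n"
      using sphere_extreme_Im[OF assms(1)] by (simp add: centre_def) }
  then show "Im z = scale n \<Longrightarrow> z = Complex (3 * scale n) (scale n)"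
     "Im z = - scale n \<Longrightarrow> z = Complex (3 * scale n) (- scale n)" by (auto simp: complex_eq_iff)
qed

lemma junctions_in_circle:
  "of_real (2 * scale n) \<in> circle (n, 0)" "of_real (4 * scale n) \<in> circle (n, 0)"
  "Complex (3 * scale n) (scale n) \<in> circle (n, 0)" "Complex (3 * scale n) (- scale n) \<in> circle (n, 0)"
  "Complex (3 * scale n) (scale n) \<in> circle (n, 1)" "Complex (3 * scale n) (- scale n) \<in> circle (n, -1)"
  by (auto simp: mem_sphere_complex less_imp_le simp del: mem_sphere)
     (auto simp: rad_def centre_def power2_eq_square)

lemma circles_touch:
  assumes "adjacent i j" "snd i \<in> {-1, 0, 1}" "snd j \<in> {-1, 0, 1}"
  shows "circle i \<inter> circle j \<noteq> {}"
proof -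
  have spine: "circle (n, 0) \<inter> circle (Suc n, 0) \<noteq> {}" for n
    using junctions_in_circle(1)[of n] junctions_in_circle(2)[of "Suc n"]
    by (auto simp: scale_Suc simp del: mem_sphere)
  have leaf: "circle (n, 0) \<inter> circle (n, s) \<noteq> {}" if "s = 1 \<or> s = -1" for n s
    using that junctions_in_circle[of n] by (auto simp del: mem_sphere)
  show ?thesis
    using assms spine leaf unfolding adjacent_def
    by (cases i; cases j) (auto simp: Int_commute simp del: mem_sphere; metis Int_commute)
qed

lemma circles_meet_imp_adjacent:
  assumes "i \<noteq> j" "circle i \<inter> circle j \<noteq> {}" "snd i \<in> {-1, 0, 1}" "snd j \<in> {-1, 0, 1}"
  shows "adjacent i j"
proof -
  obtain m s n t where ij: "i = (m, s)" "j = (n, t)" by (cases i; cases j)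
  obtain z where z: "z \<in> circle (m, s)" "z \<in> circle (n, t)" using assms ij by blast
  note b = circle_bounds[OF z(1)] circle_bounds[OF z(2)]
  have *: "n' = Suc m' \<and> s' = 0 \<and> t' = 0" if "m' < n'" "z \<in> circle (m', s')" "z \<in> circle (n', t')" for m' n' s' t'
  proof -
    note b = circle_bounds[OF that(2)] circle_bounds[OF that(3)]
    have "n' = Suc m'"
    proof (rule ccontr)
      assume "n' \<noteq> Suc m'"
      then have "Suc m' < n'" using that by simp
      from scale_less[OF this] show False using b scale_pos[of n'] by (auto simp: scale_Suc)
    qed
    then show ?thesis using b by (auto simp: scale_Suc)
  qed
  show ?thesis
  proof (cases m n rule: linorder_cases)
    case less then show ?thesis using *[OF less z] ij by (auto simp: adjacent_def)
  next
    case greater then show ?thesis using *[OF greater z(2,1)] ij by (auto simp: adjacent_def)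
  next
    case equal
    then show ?thesis using assms ij b scale_pos[of n] by (auto simp: adjacent_def)
  qed
qed

section \<open>The simple closed curves of a cactus\<close>

text \<open>
  All circles lie on one side of the vertical line through the left end of a chain circle, and those
  that reach it are tangent to it at that point. The junctions of the chain are thus visible from
  one coordinate alone.
\<close>

lemma cactus_vertical:
  assumes "z \<in> cactus A" "Re z = 2 * scale n"
  shows "z = of_real (2 * scale n)"
proof -
  have "z \<noteq> 0" using assms(2) by force
  then obtain m s where z: "z \<in> circle (m, s)" using assms(1) by (fastforce simp: cactus_def)
  show ?thesis
  proof (cases m n rule: linorder_cases)
    case less
    then show ?thesis
      using scale_less[OF less] circle_bounds(1)[OF z] assms(2) scale_pos[of n] by linarith
  next
    case equal
    then show ?thesis using circle_left_right(1)[OF z] assms(2) by simp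
  next
    case greater
    then have "Re z = 4 * scale m" "4 * scale m = 2 * scale n"
      using scale_less[OF greater] circle_bounds(2)[OF z] assms(2) by linarith+
    then show ?thesis using circle_left_right(2)[OF z] by metis
  qed
qed

text \<open>
  Neighbouring chain circles reach this strip only in points that also belong to the \<open>n\<close>-th circle.
\<close>

lemma cactus_strip:
  assumes "z \<in> cactus A" "2 * scale n \<le> Re z" "Re z \<le> 4 * scale n"
  shows "\<exists>s. (n, s) \<in> nodes A \<and> z \<in> circle (n, s)"
proof -
  have "z \<noteq> 0" using assms(2) scale_pos[of n] by force
  then obtain m s where z: "z \<in> circle (m, s)" "(m, s) \<in> nodes A"
    using assms(1) by (fastforce simp: cactus_def)
  have n0: "(n, 0) \<in> nodes A" by (simp add: nodes_def)
  show ?thesis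
  proof (cases m n rule: linorder_cases)
    case less
    then have "Re z = 2 * scale m" "2 * scale m = 4 * scale n"
      using scale_less[OF less] circle_bounds(1)[OF z(1)] assms by linarith+
    then have "z = of_real (4 * scale n)" using circle_left_right(1)[OF z(1)] by metis
    then show ?thesis using junctions_in_circle(2)[of n] n0 by metis
  next
    case equal
    then show ?thesis using z by blast
  next
    case greater
    then have "Re z = 4 * scale m" "4 * scale m = 2 * scale n"
      using scale_less[OF greater] circle_bounds(2)[OF z(1)] assms by linarith+
    then have "z = of_real (2 * scale n)" using circle_left_right(2)[OF z(1)] by metis
    then show ?thesis using junctions_in_circle(1)[of n] n0 by metis
  qed
qed

text \<open>
  A simple closed curve has no cut point, so each vertical line through a junction leaves it on one
  side. It is not the single point 0, so it lies in the vertical strip of one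
  chain circle; the horizontal lines through the top and the bottom of the chain circle
  then separate that circle from its leaves.
\<close>

lemma embedded_circle_in_cactus:
  fixes f :: "complex \<Rightarrow> complex"
  assumes f: "continuous_on (sphere a r) f" "inj_on f (sphere a r)" and r: "r > 0"
    and sub: "f ` sphere a r \<subseteq> cactus A"
  shows "\<exists>i\<in>nodes A. f ` sphere a r = circle i"
proof -
  define T where "T = f ` sphere a r"
  have T: "T \<subseteq> cactus A" using sub by (simp add: T_def)
  have cut: "connected (T - {p})" for p
    unfolding T_def by (rule image_sphere_no_cut_point[OF f r])
  have "a + of_real r \<in> sphere a r" "a - of_real r \<in> sphere a r" "a + of_real r \<noteq> a - of_real r"
    using r by (auto simp: dist_norm)
  then have not_point: "\<exists>z\<in>T. z \<noteq> p" for p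
    unfolding T_def using f(2) by (metis image_eqI inj_onD)
  have whole: "T = circle i" if "T \<subseteq> circle i" for i
    using embedded_circle_in_circle[OF f r _ rad_pos] that by (simp add: T_def)
  have vertical: "(\<forall>z\<in>T. Re z \<le> 2 * scale n) \<or> (\<forall>z\<in>T. 2 * scale n \<le> Re z)" for n
    by (rule no_cut_point_one_sided[OF cut, where p = "of_real (2 * scale n)"])
      (use T cactus_vertical in \<open>auto intro!: continuous_intros\<close>)
  have Re_pos: "Re z > 0" if z: "z \<in> T" "z \<noteq> 0" for z
  proof -
    obtain m s where "z \<in> circle (m, s)" using T z by (fastforce simp: cactus_def)
    from circle_bounds(1)[OF this] show ?thesis using scale_pos[of m] by linarith
  qed
  have "\<exists>n. \<forall>z\<in>T. 2 * scale n \<le> Re z"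
  proof (rule ccontr)
    assume "\<nexists>n. \<forall>z\<in>T. 2 * scale n \<le> Re z"
    then have *: "\<forall>z\<in>T. Re z \<le> 2 * scale n" for n using vertical by blast
    obtain z where z: "z \<in> T" "z \<noteq> 0" using not_point by blast
    then obtain n where "scale n < Re z / 2" using Re_pos scale_small[of "Re z / 2"] by auto
    then show False using *[of n] z(1) by (simp add: not_le[symmetric] mult.commute)
  qed
  (* The least n for which the curve lies to the right of the left end of circle n:
     by minimality it also lies to the left of the right end of that circle, which for n > 0
     is the left end of circle n - 1 and for n = 0 bounds the whole cactus. *)
  define n where "n = (LEAST n. \<forall>z\<in>T. 2 * scale n \<le> Re z)"
  have n: "\<forall>z\<in>T. 2 * scale n \<le> Re z"
    unfolding n_def by (rule LeastI_ex) fact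
  have least: "\<not> (\<forall>z\<in>T. 2 * scale m \<le> Re z)" if "m < n" for m
    using not_less_Least that unfolding n_def by blast
  have right: "Re z \<le> 4 * scale n" if z: "z \<in> T" for z
  proof (cases n)
    case 0
    have "z \<noteq> 0" using n z scale_pos[of n] by force
    then obtain m s where ms: "z \<in> circle (m, s)" using T z by (fastforce simp: cactus_def)
    have "scale m \<le> 1" by (simp add: scale_def power_le_one)
    then show ?thesis using circle_bounds(2)[OF ms] 0 by simp
  next
    case (Suc m)
    then have "\<forall>z\<in>T. Re z \<le> 2 * scale m" using least vertical by blast
    then show ?thesis using z Suc by (auto simp: scale_Suc)
  qed
  have strip: "\<exists>s. (n, s) \<in> nodes A \<and> z \<in> circle (n, s)" if "z \<in> T" for z
    using cactus_strip T n right that by blast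
  have snd: "s \<in> {-1, 0, 1}" if "(n, s) \<in> nodes A" for s
    using nodes_snd[OF that] by simp
  have meets: "Im z = scale n \<Longrightarrow> z = Complex (3 * scale n) (scale n)"
      "Im z = - scale n \<Longrightarrow> z = Complex (3 * scale n) (- scale n)" if z: "z \<in> T" for z
  proof -
    obtain s where s: "(n, s) \<in> nodes A" "z \<in> circle (n, s)" using strip[OF z] by blast
    show "Im z = scale n \<Longrightarrow> z = Complex (3 * scale n) (scale n)"
      "Im z = - scale n \<Longrightarrow> z = Complex (3 * scale n) (- scale n)"
      using circle_top_bottom[OF s(2) snd[OF s(1)]] by blast+
  qed
  have above: "(\<forall>z\<in>T. Im z \<le> scale n) \<or> (\<forall>z\<in>T. scale n \<le> Im z)"
    by (rule no_cut_point_one_sided[OF cut, where p = "Complex (3 * scale n) (scale n)"])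
      (use meets(1) in \<open>auto intro!: continuous_intros\<close>)
  have below: "(\<forall>z\<in>T. Im z \<le> - scale n) \<or> (\<forall>z\<in>T. - scale n \<le> Im z)"
    by (rule no_cut_point_one_sided[OF cut, where p = "Complex (3 * scale n) (- scale n)"])
      (use meets(2) in \<open>auto intro!: continuous_intros\<close>)
  consider (top) "\<forall>z\<in>T. scale n \<le> Im z" | (bottom) "\<forall>z\<in>T. Im z \<le> - scale n"
    | (mid) "\<forall>z\<in>T. Im z \<le> scale n" "\<forall>z\<in>T. - scale n \<le> Im z"
    using above below by blast
  then show ?thesis
  proof cases
    case top
    have *: "(n, 1) \<in> nodes A \<and> z \<in> circle (n, 1) \<or> z = Complex (3 * scale n) (scale n)" if z: "z \<in> T" for z
    proof -
      obtain s where s: "(n, s) \<in> nodes A" "z \<in> circle (n, s)" using strip[OF z] by blast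
      have "scale n \<le> Im z" using top z by blast
      then have "s = 1 \<or> Im z = scale n"
        using snd[OF s(1)] circle_bounds(5,7)[OF s(2)] scale_pos[of n] by (elim insertE) auto
      then show ?thesis using s meets(1)[OF z] by blast
    qed
    obtain z where "z \<in> T" "z \<noteq> Complex (3 * scale n) (scale n)" using not_point by blast
    then have "(n, 1) \<in> nodes A" using * by blast
    moreover have "T \<subseteq> circle (n, 1)" using * junctions_in_circle(5)[of n] by blast
    ultimately show ?thesis using whole unfolding T_def by blast
  next
    case bottom
    have *: "(n, -1) \<in> nodes A \<and> z \<in> circle (n, -1) \<or> z = Complex (3 * scale n) (- scale n)" if z: "z \<in> T" for z
    proof -
      obtain s where s: "(n, s) \<in> nodes A" "z \<in> circle (n, s)" using strip[OF z] by blast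
      have "Im z \<le> - scale n" using bottom z by blast
      then have "s = -1 \<or> Im z = - scale n"
        using snd[OF s(1)] circle_bounds(5,6)[OF s(2)] scale_pos[of n] by (elim insertE) auto
      then show ?thesis using s meets(2)[OF z] by blast
    qed
    obtain z where "z \<in> T" "z \<noteq> Complex (3 * scale n) (- scale n)" using not_point by blast
    then have "(n, -1) \<in> nodes A" using * by blast
    moreover have "T \<subseteq> circle (n, -1)" using * junctions_in_circle(6)[of n] by blast
    ultimately show ?thesis using whole unfolding T_def by blast
  next
    case mid
    have "z \<in> circle (n, 0)" if z: "z \<in> T" for z
    proof -
      obtain s where s: "(n, s) \<in> nodes A" "z \<in> circle (n, s)" using strip[OF z] by blast
      have "Im z \<le> scale n" "- scale n \<le> Im z" using mid z by blast+
      then consider "s = 0" | "Im z = scale n" | "Im z = - scale n"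
        using snd[OF s(1)] circle_bounds(6,7)[OF s(2)] by fastforce
      then show ?thesis
        using s(2) meets[OF z] junctions_in_circle(3,4)[of n] by cases metis+
    qed
    then have "T \<subseteq> circle (n, 0)" by blast
    moreover have "(n, 0) \<in> nodes A" by (simp add: nodes_def)
    ultimately show ?thesis using whole unfolding T_def by blast
  qed
qed

section \<open>Rigidity of the adjacency tree\<close>

lemma leaf_neighbour: "adjacent (n, s) j \<Longrightarrow> s \<noteq> 0 \<Longrightarrow> j = (n, 0)"
  by (cases j) (auto simp: adjacent_def)

lemma spine_neighbour:
  "adjacent (n, 0) j \<Longrightarrow> j \<in> nodes A \<Longrightarrow>
    j = (Suc n, 0) \<or> (n > 0 \<and> (j = (n - 1, 0) \<or> j = (n, 1))) \<or> (n = 1 \<and> j = (n, -1))"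
  by (cases j) (auto simp: adjacent_def nodes_def)

text \<open>
  Excludes, as images of inner chain nodes, the leaves and the end node of the chain.
\<close>

lemma two_neighbours:
  assumes "adjacent v j" "adjacent v k" "j \<noteq> k" "j \<in> nodes A" "k \<in> nodes A"
  shows "snd v = 0 \<and> fst v > 0"
proof -
  obtain n s where v: "v = (n, s)" by (cases v)
  have s: "s = 0" using assms(1-3) leaf_neighbour v by metis
  have "n > 0"
  proof (rule ccontr)
    assume "\<not> n > 0"
    then have "j = (Suc n, 0)" "k = (Suc n, 0)"
      using assms spine_neighbour[of n j A] spine_neighbour[of n k A] unfolding v s by auto
    then show False using assms(3) by simp
  qed
  then show ?thesis using v s by simp
qed

text \<open>
  A leaf has one neighbour, and a chain circle other than the one at position 1 has at most three:
  its two neighbours in the chain and an upper leaf.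
\<close>

lemma four_neighbours:
  assumes "J \<subseteq> nodes A" "card J = 4" "\<And>j. j \<in> J \<Longrightarrow> adjacent v j"
  shows "v = (1, 0)"
proof (rule ccontr)
  assume v: "v \<noteq> (1, 0)"
  obtain n s where ns: "v = (n, s)" by (cases v)
  have J: "adjacent (n, s) j" "j \<in> nodes A" if "j \<in> J" for j using assms that ns by auto
  have "\<exists>x y z. J \<subseteq> {x, y, z}"
  proof (cases "s = 0")
    case False
    then have "J \<subseteq> {(n, 0), (n, 0), (n, 0)}" using J leaf_neighbour by blast
    then show ?thesis by blast
  next
    case True
    then have "n \<noteq> 1" using v ns by simp
    have "J \<subseteq> {(Suc n, 0), (n - 1, 0), (n, 1)}"
    proof
      fix j assume "j \<in> J"
      then show "j \<in> {(Suc n, 0), (n - 1, 0), (n, 1)}"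
        using spine_neighbour[of n j A] J[of j] True \<open>n \<noteq> 1\<close> by blast
    qed
    then show ?thesis by blast
  qed
  then obtain x y z where "J \<subseteq> {x, y, z}" by blast
  then have "card J \<le> card {x, y, z}" by (intro card_mono) auto
  also have "\<dots> \<le> 3" by (simp add: card_insert_if)
  finally show False using assms(2) by simp
qed

text \<open>
  The node at position 1 is recognised by its four neighbours. From there the chain can only be
  followed upwards: the next node has a further neighbour, so it is not sent to
  a leaf, and injectivity forbids turning back. Once the chain is fixed, a leaf has nowhere to go
  but to a leaf at the same position.
\<close>

lemma node_embedding_imp_subset:
  assumes im: "\<And>i. i \<in> nodes A \<Longrightarrow> \<phi> i \<in> nodes B" and inj: "inj_on \<phi> (nodes A)"
    and adj: "\<And>i j. i \<in> nodes A \<Longrightarrow> j \<in> nodes A \<Longrightarrow> adjacent i j \<Longrightarrow> adjacent (\<phi> i) (\<phi> j)"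
  shows "A \<subseteq> B"
proof -
  have spine: "(n, 0) \<in> nodes A" for n by (simp add: nodes_def)
  have steps: "adjacent (n, 0) (Suc n, 0)" "adjacent (Suc n, 0) (n, 0)" "s \<noteq> 0 \<Longrightarrow> adjacent (n, 0) (n, s)" for n s
    by (auto simp: adjacent_def)
  have base: "\<phi> (1, 0) = (1, 0)"
  proof (rule four_neighbours)
    let ?J = "{(0, 0), (2, 0), (1, 1), (1, -1)} :: (nat \<times> int) set"
    have J: "?J \<subseteq> nodes A" by (auto simp: nodes_def)
    show "\<phi> ` ?J \<subseteq> nodes B" using J im by blast
    have "card (\<phi> ` ?J) = card ?J" by (rule card_image[OF inj_on_subset[OF inj J]])
    then show "card (\<phi> ` ?J) = 4" by simp
    have "adjacent (1, 0) j" if "j \<in> ?J" for j using that by (auto simp: adjacent_def)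
    then show "adjacent (\<phi> (1, 0)) j" if "j \<in> \<phi> ` ?J" for j
      using that adj[OF spine] J by blast
  qed
  have fixed: "\<phi> (Suc n, 0) = (Suc n, 0)" for n
  proof (induction n rule: less_induct)
    case (less n)
    show ?case
    proof (cases n)
      case 0
      then show ?thesis using base by simp
    next
      case (Suc m)
      then have n: "\<phi> (n, 0) = (n, 0)" using less by simp
      define v where "v = \<phi> (Suc n, 0)"
      have v: "adjacent (n, 0) v" "adjacent v (n, 0)" "adjacent v (\<phi> (Suc (Suc n), 0))"
        using adj[OF spine spine steps(1)[of n]] adj[OF spine spine steps(2)[of n]]
          adj[OF spine spine steps(1)[of "Suc n"]] n by (simp_all add: v_def)
      have "\<phi> (Suc (Suc n), 0) \<noteq> \<phi> (n, 0)" using inj_onD[OF inj _ spine spine, of "Suc (Suc n)" n] by auto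
      then have pos: "snd v = 0 \<and> fst v > 0"
        using two_neighbours[OF v(2,3), of B] n im[OF spine] by metis
      (* Position 0 is not yet known to be fixed, but its node has only one neighbour. *)
      have "v \<noteq> (m, 0)"
      proof (cases m)
        case 0
        then show ?thesis using pos by auto
      next
        case (Suc k)
        then have "\<phi> (m, 0) = (m, 0)" using less \<open>n = Suc m\<close> by simp
        then show ?thesis
          using inj_onD[OF inj _ spine spine, of "Suc n" m] \<open>n = Suc m\<close> by (auto simp: v_def)
      qed
      moreover have "v \<in> nodes B" using im[OF spine] by (simp add: v_def)
      ultimately have "v = (Suc n, 0)" using spine_neighbour[OF v(1), of B] pos Suc by auto
      then show ?thesis by (simp add: v_def)
    qed
  qed
  show "A \<subseteq> B"
  proof
    fix a assume "a \<in> A"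
    define v where "v = \<phi> (a + 2, 1)"
    have a: "(a + 2, 1) \<in> nodes A" using \<open>a \<in> A\<close> by (simp add: nodes_def)
    have fix': "\<phi> (a + 2, 0) = (a + 2, 0)" "\<phi> (a + 1, 0) = (a + 1, 0)" "\<phi> (a + 3, 0) = (a + 3, 0)"
      using fixed[of "a + 1"] fixed[of a] fixed[of "a + 2"] by (simp_all add: numeral_eq_Suc)
    have "adjacent (a + 2, 0) v"
      using adj[OF spine a steps(3)] fix'(1) by (simp add: v_def)
    moreover have vB: "v \<in> nodes B" using im a by (simp add: v_def)
    moreover have "v \<noteq> (a + 1, 0)" "v \<noteq> (a + 3, 0)"
      using inj_onD[OF inj _ a spine, of "a + 1"] inj_onD[OF inj _ a spine, of "a + 3"] fix' by (auto simp: v_def)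
    ultimately have "v = (a + 2, 1)" using spine_neighbour[of "a + 2" v B] by (auto simp: numeral_eq_Suc)
    then show "a \<in> B" using vB by (auto simp: nodes_def)
  qed
qed

text \<open>
  The image of each circle is a simple closed curve, hence a circle; touching circles have touching
  images, and different circles have different images, so the rigidity of the trees applies.
\<close>

lemma cactus_embedding_imp_subset:
  assumes f: "continuous_on (cactus A) f" "inj_on f (cactus A)" "f ` cactus A \<subseteq> cactus B"
  shows "A \<subseteq> B"
proof -
  have sub: "circle i \<subseteq> cactus A" if "i \<in> nodes A" for i
    using that by (auto simp: cactus_def simp del: mem_sphere)
  have "\<exists>j\<in>nodes B. f ` circle i = circle j" if "i \<in> nodes A" for i
    by (rule embedded_circle_in_cactus[OF _ _ rad_pos])
      (use sub[OF that] f continuous_on_subset inj_on_subset in blast)+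
  then obtain \<phi> where \<phi>: "\<And>i. i \<in> nodes A \<Longrightarrow> \<phi> i \<in> nodes B"
    "\<And>i. i \<in> nodes A \<Longrightarrow> f ` circle i = circle (\<phi> i)" by metis
  show ?thesis
  proof (rule node_embedding_imp_subset[OF \<phi>(1)])
    show inj: "inj_on \<phi> (nodes A)"
    proof (rule inj_onI)
      fix i j assume ij: "i \<in> nodes A" "j \<in> nodes A" "\<phi> i = \<phi> j"
      then have "f ` circle i = f ` circle j" using \<phi>(2) by metis
      then have "circle i = circle j" using inj_on_image_eq_iff[OF f(2)] sub ij by blast
      then show "i = j" by (rule circle_inj)
    qed
    fix i j assume ij: "i \<in> nodes A" "j \<in> nodes A" "adjacent i j"
    then have "circle i \<inter> circle j \<noteq> {}" using circles_touch nodes_snd by blast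
    then have "circle (\<phi> i) \<inter> circle (\<phi> j) \<noteq> {}" using \<phi>(2)[OF ij(1)] \<phi>(2)[OF ij(2)] by blast
    moreover have "i \<noteq> j" using ij(3) by (auto simp: adjacent_def)
    then have "\<phi> i \<noteq> \<phi> j" using inj ij by (auto dest: inj_onD)
    ultimately show "adjacent (\<phi> i) (\<phi> j)"
      using circles_meet_imp_adjacent nodes_snd \<phi>(1) ij by metis
  qed
qed

section \<open>Compactness and path-connectedness\<close>

text \<open>
  Up to a ball of radius \<open>6 * scale n\<close> around 0 the cactus is a finite union of circles, and it is the
  intersection of these closed approximations.
\<close>

lemma compact_cactus: "compact (cactus A)"
proof -
  define U where "U n = cball 0 (6 * scale n) \<union> (\<Union>i\<in>{i \<in> nodes A. fst i < n}. circle i)" for n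
  have small: "z \<in> cball 0 (6 * scale n)" if z: "z \<in> circle i" "i \<in> nodes A" "n \<le> fst i" for z i n
  proof -
    obtain m s where i: "i = (m, s)" by (cases i)
    have s: "s \<in> {-1, 0, 1}" using nodes_snd[OF z(2)] i by simp
    have "z \<in> circle (m, s)" using z i by simp
    note b = circle_bounds(1,2)[OF this] circle_bounds(8)[OF this s]
    have "scale m \<le> scale n" using z(3) i by (simp add: scale_def power_decreasing)
    moreover have "cmod z \<le> \<bar>Re z\<bar> + \<bar>Im z\<bar>" by (rule cmod_le)
    ultimately show ?thesis using b scale_pos[of m] by simp
  qed
  have "cactus A = (\<Inter>n. U n)"
  proof (intro equalityI subsetI INT_I)
    fix z n assume "z \<in> cactus A"
    then consider "z = 0" | i where "i \<in> nodes A" "z \<in> circle i" by (fastforce simp: cactus_def)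
    then show "z \<in> U n"
    proof cases
      case 1
      then show ?thesis by (simp add: U_def)
    next
      case 2
      show ?thesis
      proof (cases "n \<le> fst i")
        case True
        then show ?thesis using small[OF 2(2,1)] unfolding U_def by blast
      next
        case False
        then have "i \<in> {i \<in> nodes A. fst i < n}" using 2(1) by simp
        then show ?thesis using 2(2) unfolding U_def by blast
      qed
    qed
  next
    fix z assume z: "z \<in> (\<Inter>n. U n)"
    show "z \<in> cactus A"
    proof (cases "z = 0")
      case False
      then obtain n where "scale n < cmod z / 6" using scale_small[of "cmod z / 6"] by auto
      then have "z \<notin> cball 0 (6 * scale n)" by simp
      then show ?thesis using z by (fastforce simp: U_def cactus_def simp del: mem_sphere mem_cball)
    qed (simp add: cactus_def)
  qed
  moreover have "closed (U n)" for n
  proof -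
    have "{i \<in> nodes A. fst i < n} \<subseteq> {..<n} \<times> {-1, 0, 1}" using nodes_snd by fastforce
    then have "finite {i \<in> nodes A. fst i < n}" by (rule finite_subset) auto
    then show ?thesis unfolding U_def by (intro closed_Un closed_UN) auto
  qed
  ultimately have "closed (cactus A)" by auto
  moreover have "cactus A \<subseteq> cball 0 6"
    using small[of _ _ 0] by (auto simp: cactus_def simp del: mem_sphere)
  then have "bounded (cactus A)" using bounded_subset bounded_cball by blast
  ultimately show ?thesis by (simp add: compact_eq_bounded_closed)
qed

lemma scale_interval:
  assumes "0 < t" "t \<le> 4"
  shows "\<exists>n. 2 * scale n \<le> t \<and> t \<le> 4 * scale n"
proof -
  have ex: "\<exists>n. 2 * scale n \<le> t"
    using scale_small[of "t / 2"] assms(1) by (auto simp: field_simps intro: less_imp_le)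
  define n where "n = (LEAST n. 2 * scale n \<le> t)"
  have "2 * scale n \<le> t" unfolding n_def by (rule LeastI_ex[OF ex])
  moreover have "t \<le> 4 * scale n"
  proof (cases n)
    case (Suc m)
    then have "\<not> 2 * scale m \<le> t" using not_less_Least[of m "\<lambda>n. 2 * scale n \<le> t"] by (simp add: n_def)
    then show ?thesis using Suc by (simp add: scale_Suc)
  qed (use assms in simp)
  ultimately show ?thesis by blast
qed

text \<open>
  The upper half of the \<open>n\<close>-th chain circle as a graph, continued by 0. The sum of these
  functions converges uniformly, and its graph runs along the tops of all chain circles, which joins
  the origin to every chain circle by a single path.
\<close>

definition bump :: "nat \<Rightarrow> real \<Rightarrow> real" where
  "bump n t = sqrt (max 0 ((scale n)\<^sup>2 - (t - 3 * scale n)\<^sup>2))"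

lemma bump_outside:
  assumes "t \<le> 2 * scale n \<or> 4 * scale n \<le> t" shows "bump n t = 0"
proof -
  have "\<bar>scale n\<bar> \<le> \<bar>t - 3 * scale n\<bar>" using assms by auto
  then have "(scale n)\<^sup>2 \<le> (t - 3 * scale n)\<^sup>2" by (simp only: abs_le_square_iff)
  then show ?thesis by (simp add: bump_def max_def)
qed

lemma suminf_bump:
  assumes "2 * scale n \<le> t" "t \<le> 4 * scale n"
  shows "(\<Sum>m. bump m t) = bump n t"
proof -
  have "bump m t = 0" if "m \<notin> {n}" for m
  proof (rule bump_outside)
    have "m < n \<or> n < m" using that by auto
    then show "t \<le> 2 * scale m \<or> 4 * scale m \<le> t"
      using scale_less[of m n] scale_less[of n m] assms by auto
  qed
  then show ?thesis using suminf_finite[of "{n}" "\<lambda>m. bump m t"] by simp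
qed

lemma continuous_on_suminf_bump: "continuous_on S (\<lambda>t. \<Sum>n. bump n t)"
proof -
  have "uniform_limit S (\<lambda>n t. \<Sum>m<n. bump m t) (\<lambda>t. \<Sum>m. bump m t) sequentially"
  proof (rule Weierstrass_m_test[where M = scale])
    fix n t
    have "max 0 ((scale n)\<^sup>2 - (t - 3 * scale n)\<^sup>2) \<le> (scale n)\<^sup>2" by simp
    then have "bump n t \<le> sqrt ((scale n)\<^sup>2)" unfolding bump_def by (rule real_sqrt_le_mono)
    moreover have "0 \<le> bump n t" by (simp add: bump_def)
    ultimately show "norm (bump n t) \<le> scale n" by simp
    show "summable scale" unfolding scale_def by (rule summable_geometric) simp
  qed
  moreover have "\<forall>\<^sub>F n in sequentially. continuous_on S (\<lambda>t. \<Sum>m<n. bump m t)"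
    unfolding bump_def by (intro always_eventually allI continuous_intros)
  ultimately show ?thesis
    by (rule uniform_limit_theorem[OF _ _ sequentially_bot, rotated])
qed

text \<open>
  Each circle is joined, directly or through its chain circle, to the path along the tops of the
  chain, which starts at 0.
\<close>

lemma path_connected_cactus: "path_connected (cactus A)"
proof -
  define \<gamma> where "\<gamma> t = Complex t (\<Sum>n. bump n t)" for t
  define G where "G = \<gamma> ` {0..4}"
  have "continuous_on {0..4} \<gamma>"
    unfolding \<gamma>_def Complex_eq by (intro continuous_intros continuous_on_suminf_bump)
  then have G: "path_connected G"
    unfolding G_def by (rule path_connected_continuous_image) simp
  have spine: "(n, 0) \<in> nodes A" for n by (simp add: nodes_def)
  have \<gamma>_circle: "\<gamma> t \<in> circle (n, 0)" if "2 * scale n \<le> t" "t \<le> 4 * scale n" for n t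
  proof -
    have "\<bar>t - 3 * scale n\<bar> \<le> \<bar>scale n\<bar>" using that by (simp add: abs_le_iff)
    then have "(t - 3 * scale n)\<^sup>2 \<le> (scale n)\<^sup>2" by (simp only: abs_le_square_iff)
    then have "(bump n t)\<^sup>2 = (scale n)\<^sup>2 - (t - 3 * scale n)\<^sup>2" by (simp add: bump_def)
    then show ?thesis
      using suminf_bump[OF that]
      by (subst mem_sphere_complex) (auto simp: \<gamma>_def centre_def rad_def)
  qed
  have "\<gamma> 0 = 0"
    using bump_outside[of 0] by (simp add: \<gamma>_def complex_eq_iff)
  then have zero: "0 \<in> G" unfolding G_def by force
  have G_sub: "G \<subseteq> cactus A"
  proof
    fix z assume "z \<in> G"
    then obtain t where t: "0 \<le> t" "t \<le> 4" "z = \<gamma> t" by (auto simp: G_def)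
    show "z \<in> cactus A"
    proof (cases "t = 0")
      case True
      then show ?thesis using t \<open>\<gamma> 0 = 0\<close> by (simp add: cactus_def)
    next
      case False
      then obtain n where "\<gamma> t \<in> circle (n, 0)" using scale_interval[of t] \<gamma>_circle t by fastforce
      then show ?thesis using spine t(3) unfolding cactus_def by blast
    qed
  qed
  define P where "P i = (G \<union> circle (fst i, 0)) \<union> circle i" for i
  have "path_connected (P i)" if i: "i \<in> nodes A" for i
  proof -
    have circ: "path_connected (circle j)" for j by (rule path_connected_sphere) simp
    have "scale (fst i) \<le> 1" by (simp add: scale_def power_le_one)
    then have "\<gamma> (4 * scale (fst i)) \<in> G \<inter> circle (fst i, 0)"
      using \<gamma>_circle[of "fst i" "4 * scale (fst i)"] by (auto simp: G_def simp del: mem_sphere)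
    then have "path_connected (G \<union> circle (fst i, 0))"
      by (intro path_connected_Un[OF G circ]) blast
    moreover have "circle (fst i, 0) \<inter> circle i \<noteq> {}"
    proof (cases "snd i = 0")
      case True
      then have "i = (fst i, 0)" by (simp add: prod_eq_iff)
      then show ?thesis using junctions_in_circle(1)[of "fst i"] by (metis IntI empty_iff)
    next
      case False
      then show ?thesis using circles_touch[of "(fst i, 0)" i] nodes_snd[OF i] by (simp add: adjacent_def)
    qed
    then have "(G \<union> circle (fst i, 0)) \<inter> circle i \<noteq> {}" by blast
    ultimately show ?thesis unfolding P_def using path_connected_Un circ by blast
  qed
  then have "path_connected (\<Union>i\<in>nodes A. P i)"
    by (rule path_connected_UNION[where z = 0]) (use zero in \<open>auto simp: P_def\<close>)
  moreover have "(\<Union>i\<in>nodes A. P i) = cactus A"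
  proof
    show "(\<Union>i\<in>nodes A. P i) \<subseteq> cactus A"
      using G_sub spine unfolding P_def cactus_def by blast
    show "cactus A \<subseteq> (\<Union>i\<in>nodes A. P i)"
      using zero spine[of 0] unfolding P_def cactus_def by blast
  qed
  ultimately show ?thesis by simp
qed

section \<open>Incomparable cacti in space\<close>

definition plane :: "complex \<Rightarrow> real ^ 3" where
  "plane z = Re z *\<^sub>R axis 1 1 + Im z *\<^sub>R axis 2 1"

definition shadow :: "real ^ 3 \<Rightarrow> complex" where
  "shadow v = Complex (v $ 1) (v $ 2)"

lemma shadow_plane [simp]: "shadow (plane z) = z"
  by (simp add: shadow_def plane_def axis_def)

lemma continuous_on_plane: "continuous_on S plane"
  unfolding plane_def by (intro continuous_intros)

lemma continuous_on_shadow: "continuous_on S shadow"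
  unfolding shadow_def Complex_eq by (intro continuous_intros)

lemma plane_cactus_embedding_imp_subset:
  assumes "S \<subseteq> plane ` cactus B" "plane ` cactus A homeomorphic S"
  shows "A \<subseteq> B"
proof -
  obtain h k where h: "homeomorphism (plane ` cactus A) S h k"
    using assms(2) unfolding homeomorphic_def by blast
  have hB: "h (plane z) \<in> plane ` cactus B" if "z \<in> cactus A" for z
    using homeomorphism_image1[OF h] assms(1) that by blast
  show ?thesis
  proof (rule cactus_embedding_imp_subset)
    show "continuous_on (cactus A) (shadow \<circ> (h \<circ> plane))"
      by (intro continuous_on_compose continuous_on_plane continuous_on_shadow homeomorphism_cont1[OF h])
    show "(shadow \<circ> (h \<circ> plane)) ` cactus A \<subseteq> cactus B"
      using hB by fastforce
    show "inj_on (shadow \<circ> (h \<circ> plane)) (cactus A)"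
    proof (rule inj_onI)
      fix x y assume xy: "x \<in> cactus A" "y \<in> cactus A"
        "(shadow \<circ> (h \<circ> plane)) x = (shadow \<circ> (h \<circ> plane)) y"
      then have "h (plane x) = h (plane y)" using hB[of x] hB[of y] by auto
      then have "plane x = plane y" using homeomorphism_apply1[OF h] xy(1,2) by (metis imageI)
      then show "x = y" by (metis shadow_plane)
    qed
  qed
qed

text \<open>
  The even part records \<open>S\<close>, the odd part its complement, so an inclusion between two codes forces
  inclusions in both directions.
\<close>

definition parity_code :: "nat set \<Rightarrow> nat set" where
  "parity_code S = (\<lambda>n. 2 * n) ` S \<union> (\<lambda>n. 2 * n + 1) ` (- S)"

lemma parity_code_subset_imp_eq:
  assumes "parity_code S \<subseteq> parity_code T" shows "S = T"
proof -
  have even: "2 * n \<in> parity_code S \<longleftrightarrow> n \<in> S" for n S by (auto simp: parity_code_def) presburger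
  have odd: "2 * n + 1 \<in> parity_code S \<longleftrightarrow> n \<notin> S" for n S by (auto simp: parity_code_def) presburger
  show ?thesis using assms even odd by (metis subset_antisym subsetD subsetI)
qed

theorem theorem2:
  "\<exists>\<F> :: (real ^ 3) set set.
     \<F> \<approx> (UNIV :: nat set set) \<and>
     incomparable \<F> (\<lambda>X. X) \<and>
     (\<forall>X\<in>\<F>. path_connected X \<and> compact X)"
proof -
  define X where "X S = plane ` cactus (parity_code S)" for S
  have embeds: "S = T" if "U \<subseteq> X T" "X S homeomorphic U" for S T U
    using plane_cactus_embedding_imp_subset[OF that[unfolded X_def]] by (rule parity_code_subset_imp_eq)
  have "inj X"
    by (rule injI) (metis embeds homeomorphic_refl subset_refl)
  then have "range X \<approx> (UNIV :: nat set set)" by (rule inj_on_image_eqpoll_self)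
  moreover have "incomparable (range X) (\<lambda>X. X)"
    unfolding incomparable_def using embeds by blast
  moreover have "path_connected (X S)" "compact (X S)" for S
    unfolding X_def
    by (intro path_connected_continuous_image compact_continuous_image continuous_on_plane
        path_connected_cactus compact_cactus)+
  ultimately show ?thesis by (intro exI[of _ "range X"]) blast
qed

end
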